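(* Let $(\Omega,\mathcal{F},\mathsf{P})$ be a complete probability space, let $\mathsf{H}$ be a separable real Hilbert space, let $\mathsf{T}\colon\mathsf{H}\to\mathsf{H}$ be a nonexpansive (i.e., $1$-Lipschitzian) operator such that $\operatorname{Fix}\mathsf{T}=\{\mathsf{x}\in\mathsf{H}\mid\mathsf{T}\mathsf{x}=\mathsf{x}\}\neq\varnothing$, and let $x_0\in L^2(\Omega,\mathcal{F},\mathsf{P};\mathsf{H})$. For every $n\in\mathbb{N}$, let $e_n\in L^2(\Omega,\mathcal{F},\mathsf{P};\mathsf{H})$, let $\mu_n\in L^\infty(\Omega,\mathcal{F},\mathsf{P};]0,1[)$ be independent of $(x_0,\ldots,x_n,e_n)$, and set $$x_{n+1}=x_n+\mu_n\big(\mathsf{T}x_n+e_n-x_n\big).$$ For every $n\in\mathbb{N}$, let $\mathcal{F}_n$ be the sub-$\sigma$-algebra of $\mathcal{F}$ generated by $(x_0,\ldots,x_n)$ and set $\theta_n=\sum_{k=0}^n\mathsf{E}\big(\mu_k(1-\mu_k)\big)$. Suppose that $$\begin{cases}\displaystyle\sum_{n\in\mathbb{N}}\mathsf{E}\big(\mu_n(1-\mu_n)\big)=+\infty,\\[2mm] \displaystyle\sum_{n\in\mathbb{N}}(\mathsf{E}\mu_n)\sqrt{\mathsf{E}(\|e_n\|^2\mid\mathcal{F}_n)}<+\infty\quad\mathsf{P}\text{-a.s.},\\[2mm] \displaystyle\sum_{n\in\mathbb{N}}\theta_n\,\mathsf{E}\Big(\frac{\mu_n}{1-\mu_n}\Big)\,\mathsf{E}(\|e_n\|^2\mid\mathcal{F}_n)<+\infty\quad\mathsf{P}\text{-a.s.}\end{cases}$$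 Then $\|\mathsf{T}x_{n+1}-x_{n+1}\|=\mathrm{o}(1/\sqrt{\theta_n})$ $\mathsf{P}$-a.s.
   Context: $L^2(\Omega,\mathcal{F},\mathsf{P};\mathsf{H})$ is the space of (a.s. equivalence classes of) $\mathsf{H}$-valued random variables $x$ with $\mathsf{E}\|x\|^2<+\infty$; $L^\infty(\Omega,\mathcal{F},\mathsf{P};]0,1[)$ denotes the (essentially bounded) random variables with values in $]0,1[$. "$u_n=\mathrm{o}(1/v_n)$ $\mathsf{P}$-a.s." means $u_nv_n\to0$ $\mathsf{P}$-a.s. as $n\to+\infty$. *)

theory Defs
  imports "HOL-Probability.Probability"
begin

definition L2_rv :: "'a measure \<Rightarrow> ('a \<Rightarrow> 'h::real_inner) set" where
  "L2_rv M = {x \<in> borel_measurable M. integrable M (\<lambda>\<omega>. (norm (x \<omega>))\<^sup>2)}"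

(* Representatives of elements of L^\<infinity>(M; ]0,1[): the values lie in ]0,1[ almost surely,
   so essential boundedness is automatic. *)
definition Linf_unit_rv :: "'a measure \<Rightarrow> ('a \<Rightarrow> real) set" where
  "Linf_unit_rv M = {\<mu> \<in> borel_measurable M. AE \<omega> in M. \<mu> \<omega> \<in> {0<..<1}}"

(* Independence of random variables with possibly different codomains; the library constant
   prob_space.indep_var requires both codomains to be the same type. This is the right-hand
   side of prob_space.indep_var_eq with that restriction removed. *)
definition indep_rv ::
  "'a measure \<Rightarrow> 'b measure \<Rightarrow> ('a \<Rightarrow> 'b) \<Rightarrow> 'c measure \<Rightarrow> ('a \<Rightarrow> 'c) \<Rightarrow> bool" where
  "indep_rv M S X T Y \<longleftrightarrow>
     X \<in> measurable M S \<and> Y \<in> measurable M T \<and>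
     prob_space.indep_set M
       (sigma_sets (space M) {X -` A \<inter> space M | A. A \<in> sets S})
       (sigma_sets (space M) {Y -` A \<inter> space M | A. A \<in> sets T})"

definition history :: "(nat \<Rightarrow> 'a \<Rightarrow> 'h) \<Rightarrow> nat \<Rightarrow> 'a \<Rightarrow> nat \<Rightarrow> 'h" where
  "history x n \<omega> = (\<lambda>i\<in>{..n}. x i \<omega>)"

abbreviation history_space :: "nat \<Rightarrow> (nat \<Rightarrow> 'h::topological_space) measure" where
  "history_space n \<equiv> PiM {..n} (\<lambda>_. borel)"

definition history_algebra ::
  "'a measure \<Rightarrow> (nat \<Rightarrow> 'a \<Rightarrow> 'h::topological_space) \<Rightarrow> nat \<Rightarrow> 'a measure" where
  "history_algebra M x n = vimage_algebra (space M) (history x n) (history_space n)"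

definition theta :: "'a measure \<Rightarrow> (nat \<Rightarrow> 'a \<Rightarrow> real) \<Rightarrow> nat \<Rightarrow> real" where
  "theta M \<mu> n = (\<Sum>k\<le>n. \<integral>\<omega>. \<mu> k \<omega> * (1 - \<mu> k \<omega>) \<partial>M)"

end

theory Submission
  imports Defs
begin

text \<open>
Fix \<open>z\<close> with \<open>T z = z\<close> and write \<open>r n = \<parallel>T (x n) - x n\<parallel>\<close>. Two inequalities hold along almost every path:
\<open>\<parallel>x (n+1) - z\<parallel>\<^sup>2 + \<mu>(1-\<mu>) (r n)\<^sup>2 \<le> \<parallel>x n - z\<parallel>\<^sup>2 + 2 \<mu> \<parallel>e\<parallel> \<parallel>x n - z\<parallel> + \<mu>\<^sup>2 \<parallel>e\<parallel>\<^sup>2\<close> and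
\<open>(r (n+1))\<^sup>2 \<le> (r n)\<^sup>2 + \<mu>/(1-\<mu>) \<parallel>e\<parallel>\<^sup>2\<close>. Taking expectations on the \<open>F n\<close>-measurable events on which the
partial sums of the conditional bounds stay below a constant replaces martingale convergence:
it turns the summability hypotheses on conditional expectations into pathwise summability of
\<open>\<mu> \<parallel>e\<parallel>\<close> and of \<open>\<theta> \<mu>/(1-\<mu>) \<parallel>e\<parallel>\<^sup>2\<close>, and, through the first inequality and independence, gives
\<open>\<Sum> E(\<mu>(1-\<mu>)) (r n)\<^sup>2 < \<infinity>\<close>. Hence \<open>\<theta> n (r (n+1))\<^sup>2\<close> is decreasing up to a summable error and converges;
its limit is \<open>0\<close> because \<open>\<Sum> E(\<mu>(1-\<mu>)) / \<theta>\<close> diverges.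
\<close>

section \<open>Deterministic sequences: convergence up to summable errors\<close>

lemma quasi_decreasing_convergent:
  fixes u c :: "nat \<Rightarrow> real"
  assumes u: "\<And>n. 0 \<le> u n" and c: "\<And>n. 0 \<le> c n" "summable c"
    and step: "\<And>n. u (Suc n) \<le> u n + c n"
  shows "convergent u"
proof -
  \<comment> \<open>Subtracting the accumulated errors makes the sequence decreasing; since
    \<open>u\<close> is nonnegative, \<open>- suminf c\<close> bounds it from below.\<close>
  define w where "w = (\<lambda>n. u n - (\<Sum>k<n. c k))"
  have "decseq w"
    using step by (intro decseq_SucI) (simp add: w_def algebra_simps)
  moreover have "- suminf c \<le> w n" for n
    using u[of n] sum_le_suminf[OF c(2), of "{..<n}"] c(1) by (simp add: w_def)
  ultimately obtain l where l: "w \<longlonglongrightarrow> l"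
    using decseq_convergent[of w "- suminf c"] by blast
  have "(\<lambda>n. w n + (\<Sum>k<n. c k)) \<longlonglongrightarrow> l + suminf c"
    by (intro tendsto_add l summable_LIMSEQ c)
  then show ?thesis
    by (auto simp: w_def convergent_def)
qed

text \<open>Abel-Dini: by divergence there are blocks arbitrarily far out over which the partial
  sums more than double. The quotients of such a block sum to more than 1/2, against the Cauchy
  criterion. Vanishing initial partial sums do no harm because \<open>0 / 0 = 0\<close>.\<close>

lemma not_summable_divide_partial_sums:
  fixes g :: "nat \<Rightarrow> real"
  assumes g: "\<And>n. 0 \<le> g n" and div: "\<not> summable g"
  shows "\<not> summable (\<lambda>n. g n / (\<Sum>k\<le>n. g k))"
proof
  define S where "S = (\<lambda>n. \<Sum>k\<le>n. g k)"
  assume "summable (\<lambda>n. g n / (\<Sum>k\<le>n. g k))"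
  then have sm: "summable (\<lambda>n. g n / S n)" by (simp add: S_def)
  have S_mono: "S m \<le> S n" if "m \<le> n" for m n
    unfolding S_def using that g by (intro sum_mono2) auto
  have S_nonneg: "0 \<le> S n" for n
    unfolding S_def using g by (intro sum_nonneg) auto
  have unbounded: "\<exists>n. B < S n" for B
  proof (rule ccontr)
    assume "\<not> (\<exists>n. B < S n)"
    then have "\<And>n. S n \<le> B" by (auto simp: not_less)
    moreover have "(\<Sum>k<n. g k) \<le> S n" for n
      unfolding S_def using g by (intro sum_mono2) auto
    ultimately have "(\<Sum>k<n. g k) \<le> B" for n
      using order_trans by blast
    then show False
      using div summableI_nonneg_bounded[of g B] g by auto
  qed
  obtain N where N: "\<And>m n. N \<le> m \<Longrightarrow> norm (\<Sum>k\<in>{m..<n}. g k / S k) < 1/2"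
    using sm unfolding summable_Cauchy by (meson half_gt_zero_iff zero_less_one)
  obtain m where m: "2 * S N < S m" using unbounded by blast
  have "N < m"
    using m S_mono[of m N] S_nonneg[of N] by (cases "m \<le> N") auto
  have "S m > 0" using m S_nonneg[of N] by linarith
  have split: "S m = S N + (\<Sum>k\<in>{Suc N..<Suc m}. g k)"
    unfolding S_def using \<open>N < m\<close>
    by (simp add: sum.atLeastLessThan_concat atMost_atLeast0 atLeastLessThanSuc_atLeastAtMost [symmetric] del: sum.op_ivl_Suc)
  have "(\<Sum>k\<in>{Suc N..<Suc m}. g k) / S m \<le> (\<Sum>k\<in>{Suc N..<Suc m}. g k / S k)"
    unfolding sum_divide_distrib
  proof (rule sum_mono)
    fix k assume k: "k \<in> {Suc N..<Suc m}"
    show "g k / S m \<le> g k / S k"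
    proof (cases "g k = 0")
      case False
      have "g k \<le> S k" unfolding S_def using g by (intro member_le_sum) auto
      with False g[of k] have "0 < S k" by linarith
      then show ?thesis
        using g[of k] S_mono[of k m] k by (intro divide_left_mono) auto
    qed simp
  qed
  also have "\<dots> < 1/2"
    using N[of "Suc N" "Suc m"] by simp
  finally show False
    using split m \<open>S m > 0\<close> by (simp add: field_simps)
qed

text \<open>The pathwise core, free of probability: on a fixed path \<open>g\<close>,
  \<open>r\<close> and \<open>c\<close> become the means of \<open>\<mu> n * (1 - \<mu> n)\<close>,
  the residual norms and the weighted squared errors.\<close>

lemma little_o_inverse_sqrt_partial_sums:
  fixes r c g :: "nat \<Rightarrow> real"
  defines "S \<equiv> \<lambda>n. \<Sum>k\<le>n. g k"
  assumes g: "\<And>n. 0 \<le> g n" "\<not> summable g"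
    and r: "\<And>n. 0 \<le> r n" and c: "\<And>n. 0 \<le> c n"
    and step: "\<And>n. (r (Suc n))\<^sup>2 \<le> (r n)\<^sup>2 + c n"
    and sum_r: "summable (\<lambda>n. g n * (r n)\<^sup>2)"
    and sum_c: "summable (\<lambda>n. S n * c n)"
  shows "(\<lambda>n. r (Suc n) * sqrt (S n)) \<longlonglongrightarrow> 0"
proof -
  \<comment> \<open>Pairing \<open>S n\<close> with \<open>r (Suc n)\<close> puts the increment
    \<open>g (Suc n)\<close> of the weight next to \<open>(r (Suc n))\<^sup>2\<close>, which is a
    term of the convergent series \<open>sum_r\<close>.\<close>
  define u where "u = (\<lambda>n. S n * (r (Suc n))\<^sup>2)"
  have S_nonneg: "0 \<le> S n" for n
    unfolding S_def using g by (intro sum_nonneg) auto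
  have S_Suc: "S (Suc n) = S n + g (Suc n)" for n
    by (simp add: S_def)
  have u_nonneg: "0 \<le> u n" for n
    using S_nonneg by (simp add: u_def)
  have "convergent u"
  proof (rule quasi_decreasing_convergent)
    fix n
    show "0 \<le> g (Suc n) * (r (Suc n))\<^sup>2 + S (Suc n) * c (Suc n)"
      using g S_nonneg c by simp
    have "S (Suc n) * (r (Suc (Suc n)))\<^sup>2 \<le> S (Suc n) * ((r (Suc n))\<^sup>2 + c (Suc n))"
      using S_nonneg step by (intro mult_left_mono)
    then show "u (Suc n) \<le> u n + (g (Suc n) * (r (Suc n))\<^sup>2 + S (Suc n) * c (Suc n))"
      by (simp add: u_def S_Suc algebra_simps)
  next
    show "summable (\<lambda>n. g (Suc n) * (r (Suc n))\<^sup>2 + S (Suc n) * c (Suc n))"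
      using sum_r sum_c by (intro summable_add) (simp_all add: summable_Suc_iff[of "\<lambda>n. g n * (r n)\<^sup>2"]
        summable_Suc_iff[of "\<lambda>n. S n * c n"])
  qed (rule u_nonneg)
  then obtain l where l: "u \<longlonglongrightarrow> l" by (auto simp: convergent_def)
  have "l = 0"
  proof (rule ccontr)
    assume "l \<noteq> 0"
    moreover have "0 \<le> l" using l u_nonneg LIMSEQ_le_const by blast
    ultimately have "0 < l" by simp
    \<comment> \<open>A positive limit would give
      \<open>1 / S n \<le> 2 / l * (r (Suc n))\<^sup>2\<close> eventually, so
      \<open>g (Suc n) / S (Suc n)\<close> would be dominated by a summable sequence, contradicting
      Abel-Dini.\<close>
    then have "eventually (\<lambda>n. l / 2 < u n) sequentially"
      using l by (intro order_tendstoD(1)[OF l]) simp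
    then have "eventually (\<lambda>n. norm (g (Suc n) / S (Suc n)) \<le> 2 / l * (g (Suc n) * (r (Suc n))\<^sup>2)) sequentially"
    proof eventually_elim
      case (elim n)
      then have "0 < u n" using \<open>0 < l\<close> by simp
      then have "0 < S n" using S_nonneg[of n] by (auto simp: u_def zero_less_mult_iff)
      then have le: "g (Suc n) / S (Suc n) \<le> g (Suc n) / S n"
        using g by (intro divide_left_mono) (auto simp: S_Suc add_pos_nonneg)
      also have "\<dots> = 2 / l * (l / 2) * (g (Suc n) / S n)"
        using \<open>0 < l\<close> by simp
      also have "\<dots> \<le> 2 / l * u n * (g (Suc n) / S n)"
        using elim \<open>0 < l\<close> \<open>0 < S n\<close> g(1)[of "Suc n"] by (intro mult_right_mono mult_left_mono) auto
      also have "\<dots> = 2 / l * (g (Suc n) * (r (Suc n))\<^sup>2)"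
        using \<open>0 < S n\<close> by (simp add: u_def)
      finally show ?case
        using g(1)[of "Suc n"] S_nonneg(1)[of "Suc n"] by simp
    qed
    moreover have "summable (\<lambda>n. 2 / l * (g (Suc n) * (r (Suc n))\<^sup>2))"
      using sum_r summable_Suc_iff[of "\<lambda>n. g n * (r n)\<^sup>2"] by (intro summable_mult) simp
    ultimately have "summable (\<lambda>n. g (Suc n) / S (Suc n))"
      by (rule summable_comparison_test_ev)
    then have "summable (\<lambda>n. g n / S n)"
      by (subst (asm) summable_Suc_iff)
    then show False
      using not_summable_divide_partial_sums[of g] g by (simp add: S_def)
  qed
  with l have "(\<lambda>n. sqrt (u n)) \<longlonglongrightarrow> sqrt 0"
    by (intro tendsto_real_sqrt) simp
  moreover have "sqrt (u n) = r (Suc n) * sqrt (S n)" for n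
    using r by (simp add: u_def real_sqrt_mult)
  ultimately show ?thesis by simp
qed

section \<open>Inner product estimates for one relaxed step\<close>

lemma norm_convex_combination_sq:
  fixes a b :: "'h::real_inner"
  shows "(norm ((1 - m) *\<^sub>R a + m *\<^sub>R b))\<^sup>2 =
    (1 - m) * (norm a)\<^sup>2 + m * (norm b)\<^sup>2 - m * (1 - m) * (norm (a - b))\<^sup>2"
  unfolding power2_norm_eq_inner
  by (simp add: inner_add_left inner_add_right inner_diff_left inner_diff_right inner_commute algebra_simps)

lemma one_lipschitz_norm_diff_le:
  fixes T :: "'h::real_normed_vector \<Rightarrow> 'h"
  assumes "1-lipschitz_on UNIV T"
  shows "norm (T a - T b) \<le> norm (a - b)"
  using assms by (auto simp: lipschitz_on_def dist_norm)

context
  fixes T :: "'h::real_inner \<Rightarrow> 'h" and m :: real and x x' e :: 'h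
  assumes T: "1-lipschitz_on UNIV T" and m: "0 < m" "m < 1"
    and x': "x' = x + m *\<^sub>R (T x + e - x)"
begin

text \<open>The error-free step is a convex combination of \<open>x - z\<close> and
  \<open>T x - z\<close>; the exact identity for its squared norm yields the gain
  \<open>m * (1 - m) * (norm (T x - x))\<^sup>2\<close>. The error enters only afterwards, by the
  triangle inequality.\<close>

lemma relaxed_step_dist_sq:
  assumes z: "T z = z"
  shows "(norm (x' - z))\<^sup>2 + m * (1 - m) * (norm (T x - x))\<^sup>2 \<le>
    (norm (x - z))\<^sup>2 + (2 * m * norm e * norm (x - z) + m\<^sup>2 * (norm e)\<^sup>2)"
proof -
  define p where "p = (1 - m) *\<^sub>R (x - z) + m *\<^sub>R (T x - z)"
  have Tx: "(norm (T x - z))\<^sup>2 \<le> (norm (x - z))\<^sup>2"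
    using one_lipschitz_norm_diff_le[OF T, of x z] z by (simp add: power_mono)
  have "(norm p)\<^sup>2 = (1 - m) * (norm (x - z))\<^sup>2 + m * (norm (T x - z))\<^sup>2
      - m * (1 - m) * (norm (T x - x))\<^sup>2"
    unfolding p_def norm_convex_combination_sq by (simp add: norm_minus_commute)
  also have "\<dots> \<le> (norm (x - z))\<^sup>2 - m * (1 - m) * (norm (T x - x))\<^sup>2"
    using mult_left_mono[OF Tx, of m] m by (simp add: algebra_simps)
  finally have p: "(norm p)\<^sup>2 + m * (1 - m) * (norm (T x - x))\<^sup>2 \<le> (norm (x - z))\<^sup>2"
    by simp
  moreover have "0 \<le> m * (1 - m) * (norm (T x - x))\<^sup>2"
    using m by simp
  ultimately have "(norm p)\<^sup>2 \<le> (norm (x - z))\<^sup>2"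
    by linarith
  then have p_le: "norm p \<le> norm (x - z)" by (rule power2_le_imp_le) simp
  have "x' - z = p + m *\<^sub>R e"
    by (simp add: x' p_def algebra_simps)
  then have "norm (x' - z) \<le> norm p + m * norm e"
    using norm_triangle_ineq[of p "m *\<^sub>R e"] m by simp
  then have "(norm (x' - z))\<^sup>2 \<le> (norm p + m * norm e)\<^sup>2"
    by (simp add: power_mono)
  also have "\<dots> = (norm p)\<^sup>2 + 2 * m * norm e * norm p + m\<^sup>2 * (norm e)\<^sup>2"
    by (simp add: power2_sum power_mult_distrib)
  \<comment> \<open>Only the cross term is coarsened; \<open>(norm p)\<^sup>2\<close> is kept
    because its bound carries the residual gain.\<close>
  also have "2 * m * norm e * norm p \<le> 2 * m * norm e * norm (x - z)"
    using p_le m by (intro mult_left_mono) auto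
  finally show ?thesis
    using p by linarith
qed

text \<open>Once the residual term is dropped, the right-hand side of the squared estimate is a
  perfect square.\<close>

lemma relaxed_step_dist:
  assumes z: "T z = z"
  shows "norm (x' - z) \<le> norm (x - z) + m * norm e"
proof (rule power2_le_imp_le)
  have "0 \<le> m * (1 - m) * (norm (T x - x))\<^sup>2"
    using m by simp
  then show "(norm (x' - z))\<^sup>2 \<le> (norm (x - z) + m * norm e)\<^sup>2"
    using relaxed_step_dist_sq[OF z] by (simp add: power2_sum power_mult_distrib mult_ac)
qed (use m in simp)

text \<open>The new residual is a convex combination of the old residual \<open>d\<close> and a
  vector \<open>u\<close>, and nonexpansiveness bounds \<open>norm (u + e)\<close> by
  \<open>norm (d + e)\<close>. The inner product this produces is absorbed by the negative term of
  the convexity identity.\<close>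

lemma relaxed_step_residual:
  "(norm (T x' - x'))\<^sup>2 \<le> (norm (T x - x))\<^sup>2 + m / (1 - m) * (norm e)\<^sup>2"
proof -
  define d where "d = T x - x"
  define u where "u = (1 / m) *\<^sub>R (T x' - T x) - e"
  have res: "T x' - x' = (1 - m) *\<^sub>R d + m *\<^sub>R u"
    using m by (simp add: x' d_def u_def algebra_simps)
  have "x' - x = m *\<^sub>R (d + e)" by (simp add: x' d_def algebra_simps)
  then have "norm (T x' - T x) \<le> m * norm (d + e)"
    using one_lipschitz_norm_diff_le[OF T, of x' x] m by simp
  moreover have "norm (u + e) = norm (T x' - T x) / m"
    using m by (simp add: u_def del: scaleR_diff_right)
  ultimately have "norm (u + e) \<le> norm (d + e)"
    using m by (simp add: pos_divide_le_eq mult.commute)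
  then have "(norm (u + e))\<^sup>2 \<le> (norm (d + e))\<^sup>2" by (simp add: power_mono)
  then have u: "(norm u)\<^sup>2 \<le> (norm d)\<^sup>2 + 2 * inner (d - u) e"
    unfolding power2_norm_eq_inner
    by (simp add: inner_add_left inner_add_right inner_diff_left inner_commute algebra_simps)
  \<comment> \<open>Young's inequality as a completed square: the weights make the coefficient of
    \<open>(norm (d - u))\<^sup>2\<close> the one that convexity supplies, which leaves
    \<open>m / (1 - m)\<close> for the error.\<close>
  have "0 \<le> m / (1 - m) * (norm ((1 - m) *\<^sub>R (d - u) - e))\<^sup>2"
    using m by simp
  also have "\<dots> = m * (1 - m) * (norm (d - u))\<^sup>2 - 2 * m * inner (d - u) e + m / (1 - m) * (norm e)\<^sup>2"
  proof -
    have eq: "(norm ((1 - m) *\<^sub>R (d - u) - e))\<^sup>2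
        = (1 - m)\<^sup>2 * (norm (d - u))\<^sup>2 - 2 * (1 - m) * inner (d - u) e + (norm e)\<^sup>2"
      unfolding power2_norm_eq_inner
      by (simp add: inner_diff_left inner_diff_right inner_commute algebra_simps power2_eq_square)
    show ?thesis
      unfolding eq using m by (simp add: field_simps power2_eq_square)
  qed
  finally have young: "2 * m * inner (d - u) e \<le>
      m * (1 - m) * (norm (d - u))\<^sup>2 + m / (1 - m) * (norm e)\<^sup>2"
    by linarith
  have "(norm (T x' - x'))\<^sup>2 = (1 - m) * (norm d)\<^sup>2 + m * (norm u)\<^sup>2 - m * (1 - m) * (norm (d - u))\<^sup>2"
    unfolding res norm_convex_combination_sq ..
  also have "\<dots> \<le> (norm d)\<^sup>2 + m / (1 - m) * (norm e)\<^sup>2"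
    using mult_left_mono[OF u, of m] m young by (simp add: algebra_simps)
  finally show ?thesis by (simp add: d_def)
qed

end

section \<open>Almost sure summability from conditional bounds by localization\<close>

lemma sum_stopped_le:
  fixes t :: "nat \<Rightarrow> ennreal"
  shows "(\<Sum>k<n. if (\<Sum>j\<le>k. t j) \<le> K then t k else 0) \<le> K"
proof (induction n)
  case (Suc n)
  show ?case
  \<comment> \<open>Either the full partial sum is at most \<open>K\<close> and dominates the
    stopped one, or the newest summand is zero and the induction hypothesis suffices.\<close>
  proof (cases "(\<Sum>j\<le>n. t j) \<le> K")
    case True
    have "(\<Sum>k<Suc n. if (\<Sum>j\<le>k. t j) \<le> K then t k else 0) \<le> (\<Sum>j<Suc n. t j)"
      by (intro sum_mono) auto
    then show ?thesis using True by (simp add: lessThan_Suc_atMost)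
  qed (use Suc in simp)
qed simp

text \<open>A result of Robbins-Siegmund type: \<open>step\<close> is the conditional inequality
  \<open>E(V (Suc n) + Y n | F n) \<le> V n + t n\<close>, tested on events of \<open>F n\<close>.
  Where the partial sums of \<open>t\<close> stay below \<open>K\<close> the errors cost at most
  \<open>K\<close> in expectation, and letting \<open>K\<close> grow exhausts almost every
  path.\<close>

lemma (in prob_space) AE_suminf_finite_of_cond_bound:
  fixes V Y t :: "nat \<Rightarrow> 'a \<Rightarrow> ennreal"
  assumes sub: "\<And>n. subalgebra M (F n)" and mono: "\<And>m n. m \<le> n \<Longrightarrow> sets (F m) \<subseteq> sets (F n)"
    and [measurable]: "\<And>n. V n \<in> borel_measurable M" "\<And>n. Y n \<in> borel_measurable M"
    and t: "\<And>n. t n \<in> borel_measurable (F n)"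
    and V0: "(\<integral>\<^sup>+\<omega>. V 0 \<omega> \<partial>M) < \<infinity>"
    and step: "\<And>n B. B \<in> sets (F n) \<Longrightarrow>
      (\<integral>\<^sup>+\<omega>. indicator B \<omega> * (V (Suc n) \<omega> + Y n \<omega>) \<partial>M) \<le> (\<integral>\<^sup>+\<omega>. indicator B \<omega> * (V n \<omega> + t n \<omega>) \<partial>M)"
    and fin: "AE \<omega> in M. (\<Sum>n. t n \<omega>) < \<infinity>"
  shows "AE \<omega> in M. (\<Sum>n. Y n \<omega>) < \<infinity>"
proof -
  have tM[measurable]: "t n \<in> borel_measurable M" for n
    using t sub measurable_from_subalg by blast
  \<comment> \<open>The sum includes index \<open>n\<close>, so the accumulated \<open>t\<close>
    never exceeds \<open>K\<close> while a path is counted; the event still lies in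
    \<open>F n\<close> because \<open>t n\<close> is \<open>F n\<close>-measurable.\<close>
  define B where "B = (\<lambda>K n. {\<omega>\<in>space M. (\<Sum>j\<le>n. t j \<omega>) \<le> of_nat K})"
  have tF: "t j \<in> borel_measurable (F n)" if "j \<le> n" for j n
    using t[of j] mono[OF that] sub[of j] sub[of n] unfolding subalgebra_def measurable_def by auto
  have BF: "B K n \<in> sets (F n)" for K n
  proof -
    have [measurable]: "(\<lambda>\<omega>. \<Sum>j\<le>n. t j \<omega>) \<in> borel_measurable (F n)"
      by (intro borel_measurable_sum tF) auto
    have eq: "B K n = {\<omega>\<in>space (F n). (\<Sum>j\<le>n. t j \<omega>) \<le> of_nat K}"
      using sub[of n] by (simp add: B_def subalgebra_def)
    show ?thesis unfolding eq by measurable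
  qed
  have BM[measurable]: "B K n \<in> sets M" for K n
    using BF[of K n] sub[of n] by (auto simp: subalgebra_def)
  have B_anti: "B K (Suc n) \<subseteq> B K n" for K n
    unfolding B_def by (auto intro: order_trans[rotated])
  have "AE \<omega> in M. (\<Sum>n. indicator (B K n) \<omega> * Y n \<omega>) \<noteq> \<infinity>" for K
  proof (rule nn_integral_PInf_AE)
    have bound: "(\<integral>\<^sup>+\<omega>. indicator (B K n) \<omega> * V n \<omega> \<partial>M) + (\<Sum>k<n. \<integral>\<^sup>+\<omega>. indicator (B K k) \<omega> * Y k \<omega> \<partial>M)
        \<le> (\<integral>\<^sup>+\<omega>. V 0 \<omega> \<partial>M) + (\<Sum>k<n. \<integral>\<^sup>+\<omega>. indicator (B K k) \<omega> * t k \<omega> \<partial>M)" for n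
    proof (induction n)
      case 0
      show ?case by (auto intro!: nn_integral_mono simp: indicator_def)
    next
      case (Suc n)
      have "(\<integral>\<^sup>+\<omega>. indicator (B K (Suc n)) \<omega> * V (Suc n) \<omega> \<partial>M) + (\<integral>\<^sup>+\<omega>. indicator (B K n) \<omega> * Y n \<omega> \<partial>M)
          \<le> (\<integral>\<^sup>+\<omega>. indicator (B K n) \<omega> * V (Suc n) \<omega> \<partial>M) + (\<integral>\<^sup>+\<omega>. indicator (B K n) \<omega> * Y n \<omega> \<partial>M)"
        using B_anti[of K n] by (intro add_right_mono nn_integral_mono) (auto simp: indicator_def)
      also have "\<dots> = (\<integral>\<^sup>+\<omega>. indicator (B K n) \<omega> * (V (Suc n) \<omega> + Y n \<omega>) \<partial>M)"
        by (subst nn_integral_add[symmetric]) (auto simp: distrib_left)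
      also have "\<dots> \<le> (\<integral>\<^sup>+\<omega>. indicator (B K n) \<omega> * (V n \<omega> + t n \<omega>) \<partial>M)"
        by (rule step[OF BF])
      also have "\<dots> = (\<integral>\<^sup>+\<omega>. indicator (B K n) \<omega> * V n \<omega> \<partial>M) + (\<integral>\<^sup>+\<omega>. indicator (B K n) \<omega> * t n \<omega> \<partial>M)"
        by (subst nn_integral_add[symmetric]) (auto simp: distrib_left)
      finally have 1: "(\<integral>\<^sup>+\<omega>. indicator (B K (Suc n)) \<omega> * V (Suc n) \<omega> \<partial>M) + (\<integral>\<^sup>+\<omega>. indicator (B K n) \<omega> * Y n \<omega> \<partial>M)
        \<le> (\<integral>\<^sup>+\<omega>. indicator (B K n) \<omega> * V n \<omega> \<partial>M) + (\<integral>\<^sup>+\<omega>. indicator (B K n) \<omega> * t n \<omega> \<partial>M)" .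
      \<comment> \<open>The middle term \<open>a\<close> may be infinite and cannot be cancelled;
        the two inequalities are chained by substitution instead.\<close>
      have telescope: "a' + (s + y) \<le> v + (r + z)"
        if "a' + y \<le> a + z" "a + s \<le> v + r" for a a' s y v r z :: ennreal
      proof -
        have "(a' + y) + s \<le> (a + s) + z"
          using add_right_mono[OF that(1), of s] by (simp add: ac_simps)
        also have "\<dots> \<le> (v + r) + z"
          by (rule add_right_mono[OF that(2)])
        finally show ?thesis by (simp add: ac_simps)
      qed
      show ?case
        unfolding sum.lessThan_Suc by (rule telescope[OF 1 Suc.IH])
    qed
    have "(\<Sum>k<n. \<integral>\<^sup>+\<omega>. indicator (B K k) \<omega> * Y k \<omega> \<partial>M) \<le> (\<integral>\<^sup>+\<omega>. V 0 \<omega> \<partial>M) + of_nat K" for n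
    proof -
      have "(\<Sum>k<n. \<integral>\<^sup>+\<omega>. indicator (B K k) \<omega> * t k \<omega> \<partial>M)
          = (\<integral>\<^sup>+\<omega>. (\<Sum>k<n. indicator (B K k) \<omega> * t k \<omega>) \<partial>M)"
        by (rule nn_integral_sum[symmetric]) measurable
      also have "\<dots> = (\<integral>\<^sup>+\<omega>. (\<Sum>k<n. if (\<Sum>j\<le>k. t j \<omega>) \<le> of_nat K then t k \<omega> else 0) \<partial>M)"
        by (intro nn_integral_cong sum.cong) (auto simp: B_def indicator_def)
      also have "\<dots> \<le> (\<integral>\<^sup>+\<omega>. of_nat K \<partial>M)"
        by (intro nn_integral_mono sum_stopped_le)
      also have "\<dots> = of_nat K" by (simp add: emeasure_space_1)
      finally have "(\<integral>\<^sup>+\<omega>. V 0 \<omega> \<partial>M) + (\<Sum>k<n. \<integral>\<^sup>+\<omega>. indicator (B K k) \<omega> * t k \<omega> \<partial>M) \<le> (\<integral>\<^sup>+\<omega>. V 0 \<omega> \<partial>M) + of_nat K"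
        by (rule add_left_mono)
      from order_trans[OF bound this] show ?thesis
        by (rule order_trans[rotated]) (simp add: add_increasing)
    qed
    then have "(\<Sum>k. \<integral>\<^sup>+\<omega>. indicator (B K k) \<omega> * Y k \<omega> \<partial>M) \<le> (\<integral>\<^sup>+\<omega>. V 0 \<omega> \<partial>M) + of_nat K"
      by (intro suminf_le_const) auto
    also have "\<dots> < \<infinity>" using V0 by (simp add: ennreal_of_nat_eq_real_of_nat)
    finally have "(\<integral>\<^sup>+\<omega>. (\<Sum>k. indicator (B K k) \<omega> * Y k \<omega>) \<partial>M) < \<infinity>"
      by (subst nn_integral_suminf) auto
    then show "(\<integral>\<^sup>+\<omega>. (\<Sum>k. indicator (B K k) \<omega> * Y k \<omega>) \<partial>M) \<noteq> \<infinity>" by simp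
  qed measurable
  then have "AE \<omega> in M. \<forall>K. (\<Sum>n. indicator (B K n) \<omega> * Y n \<omega>) \<noteq> \<infinity>"
    by (simp add: AE_all_countable)
  with fin AE_space[of M] show ?thesis
  proof eventually_elim
    case (elim \<omega>)
    \<comment> \<open>An integer above the total of \<open>t\<close> keeps the path in every
      \<open>B K n\<close>, so all indicators equal 1 and the localized series is the whole
      one.\<close>
    obtain a K where "(\<Sum>n. t n \<omega>) = ennreal a" "a \<le> real K"
      using elim(1) real_arch_simple less_top_ennreal by (metis infinity_ennreal_def)
    then have K: "(\<Sum>n. t n \<omega>) \<le> of_nat K"
      by (simp add: ennreal_of_nat_eq_real_of_nat ennreal_leI)
    have "(\<Sum>j\<le>n. t j \<omega>) \<le> of_nat K" for n
      using sum_le_suminf[of "\<lambda>n. t n \<omega>" "{..n}"] order_trans[OF _ K] by simp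
    then have "\<omega> \<in> B K n" for n using elim(2) by (simp add: B_def)
    then have "(\<Sum>n. indicator (B K n) \<omega> * Y n \<omega>) = (\<Sum>n. Y n \<omega>)" by simp
    moreover have "(\<Sum>n. indicator (B K n) \<omega> * Y n \<omega>) \<noteq> \<infinity>" using elim(3) by blast
    ultimately show ?case by (simp add: less_top)
  qed
qed

section \<open>Independence and conditional expectation for nonnegative integrals\<close>

lemma (in prob_space) nn_integral_mult_indep_rv:
  assumes ind: "indep_rv M S X N Z" and f: "f \<in> borel_measurable S"
    and g: "g \<in> borel_measurable (vimage_algebra (space M) Z N)"
  shows "(\<integral>\<^sup>+\<omega>. f (X \<omega>) * g \<omega> \<partial>M) = (\<integral>\<^sup>+\<omega>. f (X \<omega>) \<partial>M) * (\<integral>\<^sup>+\<omega>. g \<omega> \<partial>M)"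
proof -
  have XZ[measurable]: "X \<in> measurable M S" "Z \<in> measurable M N"
    and ind': "indep_set (sigma_sets (space M) {X -` A \<inter> space M |A. A \<in> sets S})
       (sigma_sets (space M) {Z -` A \<inter> space M |A. A \<in> sets N})"
    using ind by (auto simp: indep_rv_def)
  have fX: "(\<lambda>\<omega>. f (X \<omega>)) \<in> borel_measurable M"
    using f by measurable
  have "sets (vimage_algebra (space M) Z N) \<subseteq> sets M"
    by (rule sets_image_in_sets) auto
  then have gM: "g \<in> borel_measurable M"
    using g by (auto simp: measurable_def)
  \<comment> \<open>Independence passes to the smaller sigma-algebras generated by
    \<open>f (X \<omega>)\<close> and \<open>g\<close>. These two variables share the codomain
    \<open>ennreal\<close>, so \<open>indep_var\<close> and its product formula apply.\<close>
  have "indep_set (sigma_sets (space M) {(\<lambda>\<omega>. f (X \<omega>)) -` A \<inter> space M |A. A \<in> sets borel})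
      (sigma_sets (space M) {g -` A \<inter> space M |A. A \<in> sets borel})"
    unfolding indep_set_def
  proof (rule indep_sets_mono_sets[OF ind'[unfolded indep_set_def]])
    fix b :: bool
    have "sigma_sets (space M) {(\<lambda>\<omega>. f (X \<omega>)) -` A \<inter> space M |A. A \<in> sets borel}
        \<subseteq> sigma_sets (space M) {X -` A \<inter> space M |A. A \<in> sets S}"
    proof (rule sigma_sets_mono', safe)
      fix A :: "ennreal set" assume "A \<in> sets borel"
      then have "f -` A \<inter> space S \<in> sets S" using f by measurable
      moreover have "(\<lambda>\<omega>. f (X \<omega>)) -` A \<inter> space M = X -` (f -` A \<inter> space S) \<inter> space M"
        using measurable_space[OF XZ(1)] by auto
      ultimately show "\<exists>B. (\<lambda>\<omega>. f (X \<omega>)) -` A \<inter> space M = X -` B \<inter> space M \<and> B \<in> sets S"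
        by blast
    qed
    moreover have "sigma_sets (space M) {g -` A \<inter> space M |A. A \<in> sets borel}
        \<subseteq> sigma_sets (space M) {Z -` A \<inter> space M |A. A \<in> sets N}"
      unfolding sets_vimage_algebra[symmetric]
      using sets_image_in_sets[OF _ g, of "space M"] by (simp add: sets_vimage_algebra)
    ultimately show "(case b of True \<Rightarrow> sigma_sets (space M) {(\<lambda>\<omega>. f (X \<omega>)) -` A \<inter> space M |A. A \<in> sets borel}
        | False \<Rightarrow> sigma_sets (space M) {g -` A \<inter> space M |A. A \<in> sets borel})
      \<subseteq> (case b of True \<Rightarrow> sigma_sets (space M) {X -` A \<inter> space M |A. A \<in> sets S}
        | False \<Rightarrow> sigma_sets (space M) {Z -` A \<inter> space M |A. A \<in> sets N})"
      by (cases b) auto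
  qed
  then have "indep_var borel (\<lambda>\<omega>. f (X \<omega>)) borel g"
    unfolding indep_var_eq using fX gM by simp
  then have "indep_vars (\<lambda>_. borel) (case_bool (\<lambda>\<omega>. f (X \<omega>)) g) UNIV"
    unfolding indep_var_def by (rule indep_vars_cong[THEN iffD1, rotated -1]) (auto split: bool.split)
  from indep_vars_nn_integral[OF _ this] show ?thesis
    by (simp add: UNIV_bool mult.commute)
qed

text \<open>\<open>real_cond_exp\<close> is the difference of the conditional expectations of
  positive and negative part, read as reals. Here the negative part vanishes and integrability makes
  the positive one finite almost everywhere, so nothing is lost in the conversion.\<close>

lemma (in sigma_finite_subalgebra) ennreal_real_cond_exp:
  assumes f: "integrable M f" "\<And>x. 0 \<le> f x"
  shows "AE x in M. ennreal (real_cond_exp M F f x) = nn_cond_exp M F (\<lambda>x. ennreal (f x)) x"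
proof -
  have [measurable]: "f \<in> borel_measurable M" using f by auto
  have "(\<integral>\<^sup>+x. nn_cond_exp M F (\<lambda>x. ennreal (f x)) x \<partial>M) = (\<integral>\<^sup>+x. ennreal (f x) \<partial>M)"
    using nn_cond_exp_intg[of "\<lambda>_. 1" "\<lambda>x. ennreal (f x)"] by simp
  also have "\<dots> \<noteq> \<infinity>" using f by (simp add: nn_integral_eq_integral)
  finally have "AE x in M. nn_cond_exp M F (\<lambda>x. ennreal (f x)) x \<noteq> \<infinity>"
    by (intro nn_integral_PInf_AE) auto
  moreover have "AE x in M. 0 = nn_cond_exp M F (\<lambda>x. 0) x"
    by (rule nn_cond_exp_F_meas) simp
  ultimately show ?thesis
  proof eventually_elim
    case (elim x)
    have "(\<lambda>x. ennreal (- f x)) = (\<lambda>x. 0)" using f(2) by (auto simp: ennreal_neg)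
    with elim show ?case by (simp add: real_cond_exp_def less_top)
  qed
qed

text \<open>Taking \<open>h\<close> with values in \<open>ennreal\<close> avoids any integrability
  condition on the product; later \<open>h\<close> contains the unbounded factor
  \<open>norm (x n \<omega> - z)\<close>.\<close>

lemma (in sigma_finite_subalgebra) nn_integral_mult_real_cond_exp:
  assumes f: "integrable M f" "\<And>x. 0 \<le> f x" and h: "h \<in> borel_measurable F"
  shows "(\<integral>\<^sup>+x. h x * ennreal (f x) \<partial>M) = (\<integral>\<^sup>+x. h x * ennreal (real_cond_exp M F f x) \<partial>M)"
proof -
  have [measurable]: "f \<in> borel_measurable M" using f by auto
  have "(\<integral>\<^sup>+x. h x * ennreal (real_cond_exp M F f x) \<partial>M)
      = (\<integral>\<^sup>+x. h x * nn_cond_exp M F (\<lambda>x. ennreal (f x)) x \<partial>M)"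
    using ennreal_real_cond_exp[OF f] by (intro nn_integral_cong_AE) auto
  then show ?thesis
    using nn_cond_exp_intg[OF h, of "\<lambda>x. ennreal (f x)"] by simp
qed

text \<open>Conditional Jensen for the square. It links the error norm, which enters the distance
  estimate linearly, to the conditional second moment in the hypotheses.\<close>

lemma (in finite_measure_subalgebra) nn_integral_mult_le_sqrt_real_cond_exp:
  assumes [measurable]: "f \<in> borel_measurable M" and f: "integrable M (\<lambda>x. (f x)\<^sup>2)" "\<And>x. 0 \<le> f x"
    and h: "h \<in> borel_measurable F"
  shows "(\<integral>\<^sup>+x. h x * ennreal (f x) \<partial>M) \<le> (\<integral>\<^sup>+x. h x * ennreal (sqrt (real_cond_exp M F (\<lambda>x. (f x)\<^sup>2) x)) \<partial>M)"
proof -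
  have int: "integrable M f"
    by (rule square_integrable_imp_integrable) (use f in auto)
  have "AE x in M. (real_cond_exp M F f x)\<^sup>2 \<le> real_cond_exp M F (\<lambda>x. (f x)\<^sup>2) x"
    by (rule real_cond_exp_jensens_inequality(2)[where I = UNIV and q = "\<lambda>x. x\<^sup>2", OF int _ _ f(1) convex_power2])
      auto
  then have "AE x in M. real_cond_exp M F f x \<le> sqrt (real_cond_exp M F (\<lambda>x. (f x)\<^sup>2) x)"
    by eventually_elim (rule real_le_rsqrt)
  then have "(\<integral>\<^sup>+x. h x * ennreal (real_cond_exp M F f x) \<partial>M) \<le>
      (\<integral>\<^sup>+x. h x * ennreal (sqrt (real_cond_exp M F (\<lambda>x. (f x)\<^sup>2) x)) \<partial>M)"
    by (intro nn_integral_mono_AE) (auto elim!: eventually_mono intro!: mult_left_mono ennreal_leI)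
  then show ?thesis
    using nn_integral_mult_real_cond_exp[OF int f(2) h] by simp
qed

section \<open>The filtration generated by the iterates\<close>

lemma borel_measurable_history_algebra:
  fixes x :: "nat \<Rightarrow> 'a \<Rightarrow> 'h::topological_space"
  assumes "k \<le> n"
  shows "x k \<in> borel_measurable (history_algebra M x n)"
proof -
  have "history x n \<in> measurable (history_algebra M x n) (history_space n)"
    unfolding history_algebra_def
    by (rule measurable_vimage_algebra1) (auto simp: history_def space_PiM)
  moreover have "(\<lambda>h. h k) \<in> measurable (history_space n) (borel :: 'h measure)"
    using assms by (intro measurable_component_singleton) auto
  ultimately have "(\<lambda>\<omega>. history x n \<omega> k) \<in> borel_measurable (history_algebra M x n)"
    by (rule measurable_compose)
  then show ?thesis using assms by (simp add: history_def)
qed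

lemma history_algebra_subset:
  assumes "space N = space M" and "\<And>k. k \<le> n \<Longrightarrow> x k \<in> borel_measurable N"
  shows "sets (history_algebra M x n) \<subseteq> sets N"
  unfolding history_algebra_def
proof (rule sets_image_in_sets[OF assms(1)])
  show "history x n \<in> measurable N (history_space n)"
    unfolding history_def [abs_def] using assms(2) by (intro measurable_restrict) auto
qed

lemma history_algebra_mono:
  "m \<le> n \<Longrightarrow> sets (history_algebra M x m) \<subseteq> sets (history_algebra M x n)"
  by (intro history_algebra_subset borel_measurable_history_algebra) (auto simp: history_algebra_def)

theorem theorem3p6:
  fixes M :: "'a measure"
    and T :: "'h::{real_inner, complete_space, second_countable_topology} \<Rightarrow> 'h"
    and x e :: "nat \<Rightarrow> 'a \<Rightarrow> 'h"
    and \<mu> :: "nat \<Rightarrow> 'a \<Rightarrow> real"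
  assumes "prob_space M"
    and "complete_measure M"
    and "1-lipschitz_on UNIV T"
    and "{z. T z = z} \<noteq> {}"
    and "x 0 \<in> L2_rv M"
    and "\<And>n. e n \<in> L2_rv M"
    and "\<And>n. \<mu> n \<in> Linf_unit_rv M"
    and "\<And>n. indep_rv M borel (\<mu> n)
                (history_space n \<Otimes>\<^sub>M borel) (\<lambda>\<omega>. (history x n \<omega>, e n \<omega>))"
    and "\<And>n. AE \<omega> in M.
           x (Suc n) \<omega> = x n \<omega> + \<mu> n \<omega> *\<^sub>R (T (x n \<omega>) + e n \<omega> - x n \<omega>)"
    and "(\<Sum>n. ennreal (\<integral>\<omega>. \<mu> n \<omega> * (1 - \<mu> n \<omega>) \<partial>M)) = \<infinity>"
    and "AE \<omega> in M.
           (\<Sum>n. ennreal ((\<integral>\<omega>'. \<mu> n \<omega>' \<partial>M) *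
                  sqrt (real_cond_exp M (history_algebra M x n) (\<lambda>\<omega>'. (norm (e n \<omega>'))\<^sup>2) \<omega>))) < \<infinity>"
    and "AE \<omega> in M.
           (\<Sum>n. ennreal (theta M \<mu> n) *
                  (\<integral>\<^sup>+\<omega>'. ennreal (\<mu> n \<omega>' / (1 - \<mu> n \<omega>')) \<partial>M) *
                  ennreal (real_cond_exp M (history_algebra M x n) (\<lambda>\<omega>'. (norm (e n \<omega>'))\<^sup>2) \<omega>)) < \<infinity>"
  shows "AE \<omega> in M.
           (\<lambda>n. norm (T (x (Suc n) \<omega>) - x (Suc n) \<omega>) * sqrt (theta M \<mu> n)) \<longlonglongrightarrow> 0"
proof -
  interpret prob_space M by fact
  note lip = assms(3) and ind = assms(8) and rec = assms(9)

  \<comment> \<open>Notation and measurability\<close>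
  obtain z where z: "T z = z" using assms(4) by auto
  define F where "F = history_algebra M x"
  define a where "a = (\<lambda>n. \<integral>\<omega>. \<mu> n \<omega> \<partial>M)"
  define g where "g = (\<lambda>n. \<integral>\<omega>. \<mu> n \<omega> * (1 - \<mu> n \<omega>) \<partial>M)"
  \<comment> \<open>The quotient may fail to be integrable near \<open>\<mu> n = 1\<close>, so its
    mean is kept in \<open>ennreal\<close>, where it can be infinite.\<close>
  define b where "b = (\<lambda>n. \<integral>\<^sup>+\<omega>. ennreal (\<mu> n \<omega> / (1 - \<mu> n \<omega>)) \<partial>M)"
  define C where "C = (\<lambda>n. real_cond_exp M (F n) (\<lambda>\<omega>. (norm (e n \<omega>))\<^sup>2))"
  define \<theta> where "\<theta> = theta M \<mu>"
  have \<theta>_sum: "\<theta> n = (\<Sum>k\<le>n. g k)" for n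
    by (simp add: \<theta>_def theta_def g_def)

  have \<mu>_meas[measurable]: "\<mu> n \<in> borel_measurable M" and \<mu>: "AE \<omega> in M. 0 < \<mu> n \<omega> \<and> \<mu> n \<omega> < 1" for n
    using assms(7)[of n] by (auto simp: Linf_unit_rv_def)
  have e_meas[measurable]: "e n \<in> borel_measurable M" and e_int: "integrable M (\<lambda>\<omega>. (norm (e n \<omega>))\<^sup>2)" for n
    using assms(6)[of n] by (auto simp: L2_rv_def)
  have T_meas[measurable]: "T \<in> borel_measurable borel"
    using lip by (intro borel_measurable_continuous_onI lipschitz_on_continuous_on)
  \<comment> \<open>Measurability of every iterate comes from here: \<open>indep_rv\<close> includes
    measurability of the pair, whose first component is the history.\<close>
  have pair[measurable]: "(\<lambda>\<omega>. (history x n \<omega>, e n \<omega>)) \<in> measurable M (history_space n \<Otimes>\<^sub>M borel)" for n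
    using ind[of n] by (simp add: indep_rv_def)
  have hist: "history x n \<in> measurable M (history_space n)" for n
    using measurable_compose[OF pair measurable_fst] by simp
  have sub: "subalgebra M (F n)" for n
    unfolding subalgebra_def F_def history_algebra_def using sets_image_in_sets[OF refl hist] by simp
  have x_F[measurable]: "x n \<in> borel_measurable (F n)" for n
    unfolding F_def by (rule borel_measurable_history_algebra) simp
  have x_meas[measurable]: "x n \<in> borel_measurable M" for n
    using x_F sub measurable_from_subalg by blast
  have C_F[measurable]: "C n \<in> borel_measurable (F n)" for n
    unfolding C_def by simp
  have C_meas[measurable]: "C n \<in> borel_measurable M" for n
    using C_F sub measurable_from_subalg by blast
  have F_mono: "sets (F m) \<subseteq> sets (F n)" if "m \<le> n" for m n
    unfolding F_def by (rule history_algebra_mono[OF that])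

  \<comment> \<open>Means of the relaxation parameters\<close>
  have "integrable M (\<mu> n)" for n
    by (rule integrable_const_bound[of _ 1]) (use \<mu>[of n] in auto)
  then have a: "ennreal (a n) = (\<integral>\<^sup>+\<omega>. ennreal (\<mu> n \<omega>) \<partial>M)" and a_nonneg: "0 \<le> a n" for n
    using \<mu>[of n] unfolding a_def
    by (auto intro!: nn_integral_eq_integral[symmetric] integral_nonneg_AE elim!: eventually_mono)
  have g_int: "integrable M (\<lambda>\<omega>. \<mu> n \<omega> * (1 - \<mu> n \<omega>))" for n
  proof (rule integrable_const_bound[of _ 1])
    show "AE \<omega> in M. norm (\<mu> n \<omega> * (1 - \<mu> n \<omega>)) \<le> 1"
      using \<mu>[of n] by eventually_elim (auto simp: abs_mult intro!: mult_le_one)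
  qed measurable
  have \<mu>_pos: "AE \<omega> in M. 0 \<le> \<mu> n \<omega> * (1 - \<mu> n \<omega>)" for n
    using \<mu>[of n] by eventually_elim simp
  then have g: "ennreal (g n) = (\<integral>\<^sup>+\<omega>. ennreal (\<mu> n \<omega> * (1 - \<mu> n \<omega>)) \<partial>M)" and g_nonneg: "0 \<le> g n" for n
    using g_int[of n] unfolding g_def
    by (auto intro!: nn_integral_eq_integral[symmetric] integral_nonneg_AE)
  have g_div: "\<not> summable g"
    using ennreal_suminf_neq_top[of g] g_nonneg assms(10) by (auto simp: g_def)
  have \<theta>_nonneg: "0 \<le> \<theta> n" for n
    unfolding \<theta>_sum using g_nonneg by (intro sum_nonneg) auto
  have \<theta>_ge: "g 0 \<le> \<theta> n" for n
    unfolding \<theta>_sum using g_nonneg by (intro member_le_sum) auto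
  \<comment> \<open>A positive \<open>g 0\<close> is a common lower bound for all
    \<open>\<theta> n\<close>, which later allows the weight to be removed from the third
    summability condition.\<close>
  have g0: "0 < g 0"
  proof (rule ccontr)
    assume "\<not> 0 < g 0"
    then have "g 0 = 0" using g_nonneg[of 0] by simp
    then have "AE \<omega> in M. \<mu> 0 \<omega> * (1 - \<mu> 0 \<omega>) = 0"
      using integral_nonneg_eq_0_iff_AE[OF g_int \<mu>_pos] by (simp add: g_def)
    with \<mu>[of 0] have "AE \<omega> in M. False" by eventually_elim auto
    then show False by simp
  qed

  \<comment> \<open>Replacing random coefficients by their means\<close>
  have indep: "(\<integral>\<^sup>+\<omega>. f (\<mu> n \<omega>) * (h \<omega> * k (e n \<omega>)) \<partial>M)
      = (\<integral>\<^sup>+\<omega>. f (\<mu> n \<omega>) \<partial>M) * (\<integral>\<^sup>+\<omega>. h \<omega> * k (e n \<omega>) \<partial>M)"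
    if h: "h \<in> borel_measurable (F n)" and [measurable]: "f \<in> borel_measurable borel" "k \<in> borel_measurable borel"
    for n h and f :: "real \<Rightarrow> ennreal" and k :: "'h \<Rightarrow> ennreal"
  proof (rule nn_integral_mult_indep_rv[OF ind])
    \<comment> \<open>\<open>?G\<close> is generated by history and error together. It contains
      \<open>F n\<close> and makes \<open>e n\<close> measurable, so the whole factor
      \<open>h \<omega> * k (e n \<omega>)\<close> is independent of \<open>\<mu> n\<close> even if
      \<open>h\<close> and \<open>e n\<close> are dependent.\<close>
    let ?G = "vimage_algebra (space M) (\<lambda>\<omega>. (history x n \<omega>, e n \<omega>)) (history_space n \<Otimes>\<^sub>M borel)"
    have G: "(\<lambda>\<omega>. (history x n \<omega>, e n \<omega>)) \<in> measurable ?G (history_space n \<Otimes>\<^sub>M borel)"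
      using measurable_space[OF pair] by (intro measurable_vimage_algebra1) auto
    have hG: "history x n \<in> measurable ?G (history_space n)" and [measurable]: "e n \<in> borel_measurable ?G"
      using measurable_compose[OF G measurable_fst] measurable_compose[OF G measurable_snd] by simp_all
    have "subalgebra ?G (F n)"
      unfolding subalgebra_def F_def history_algebra_def using sets_image_in_sets[OF _ hG] by simp
    then have [measurable]: "h \<in> borel_measurable ?G"
      using h by (rule measurable_from_subalg)
    show "(\<lambda>\<omega>. h \<omega> * k (e n \<omega>)) \<in> borel_measurable ?G"
      by measurable
  qed measurable

  \<comment> \<open>First independence replaces \<open>\<mu> n\<close> by its mean, then Jensen
    replaces the error norm by the root of its conditional second moment.\<close>
  have cond1: "(\<integral>\<^sup>+\<omega>. h \<omega> * ennreal (\<mu> n \<omega> * norm (e n \<omega>)) \<partial>M) \<le> (\<integral>\<^sup>+\<omega>. h \<omega> * ennreal (a n * sqrt (C n \<omega>)) \<partial>M)"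
    if h: "h \<in> borel_measurable (F n)" for n h
  proof -
    interpret F: finite_measure_subalgebra M "F n"
      by unfold_locales (rule sub)
    have [measurable]: "h \<in> borel_measurable M" using h sub measurable_from_subalg by blast
    have "(\<integral>\<^sup>+\<omega>. h \<omega> * ennreal (\<mu> n \<omega> * norm (e n \<omega>)) \<partial>M)
        = (\<integral>\<^sup>+\<omega>. ennreal (\<mu> n \<omega>) * (h \<omega> * ennreal (norm (e n \<omega>))) \<partial>M)"
      by (simp add: ennreal_mult'' mult_ac)
    also have "\<dots> = ennreal (a n) * (\<integral>\<^sup>+\<omega>. h \<omega> * ennreal (norm (e n \<omega>)) \<partial>M)"
      unfolding a by (rule indep[OF h]) measurable
    also have "\<dots> \<le> ennreal (a n) * (\<integral>\<^sup>+\<omega>. h \<omega> * ennreal (sqrt (C n \<omega>)) \<partial>M)"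
      unfolding C_def using h e_int
      by (intro mult_left_mono F.nn_integral_mult_le_sqrt_real_cond_exp) auto
    also have "\<dots> = (\<integral>\<^sup>+\<omega>. ennreal (a n) * (h \<omega> * ennreal (sqrt (C n \<omega>))) \<partial>M)"
      by (rule nn_integral_cmult[symmetric]) measurable
    finally show ?thesis
      using a_nonneg by (simp add: ennreal_mult' mult_ac)
  qed

  have cond2: "(\<integral>\<^sup>+\<omega>. h \<omega> * (ennreal (\<mu> n \<omega> / (1 - \<mu> n \<omega>)) * ennreal ((norm (e n \<omega>))\<^sup>2)) \<partial>M)
      = (\<integral>\<^sup>+\<omega>. h \<omega> * (b n * ennreal (C n \<omega>)) \<partial>M)"
    if h: "h \<in> borel_measurable (F n)" for n h
  proof -
    interpret F: finite_measure_subalgebra M "F n"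
      by unfold_locales (rule sub)
    have [measurable]: "h \<in> borel_measurable M" using h sub measurable_from_subalg by blast
    have "(\<integral>\<^sup>+\<omega>. h \<omega> * (ennreal (\<mu> n \<omega> / (1 - \<mu> n \<omega>)) * ennreal ((norm (e n \<omega>))\<^sup>2)) \<partial>M)
        = (\<integral>\<^sup>+\<omega>. ennreal (\<mu> n \<omega> / (1 - \<mu> n \<omega>)) * (h \<omega> * ennreal ((norm (e n \<omega>))\<^sup>2)) \<partial>M)"
      by (simp add: mult_ac)
    also have "\<dots> = b n * (\<integral>\<^sup>+\<omega>. h \<omega> * ennreal ((norm (e n \<omega>))\<^sup>2) \<partial>M)"
      unfolding b_def by (rule indep[OF h, of "\<lambda>m. ennreal (m / (1 - m))"]) measurable
    also have "\<dots> = b n * (\<integral>\<^sup>+\<omega>. h \<omega> * ennreal (C n \<omega>) \<partial>M)"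
      unfolding C_def using h e_int by (subst F.nn_integral_mult_real_cond_exp) auto
    also have "\<dots> = (\<integral>\<^sup>+\<omega>. b n * (h \<omega> * ennreal (C n \<omega>)) \<partial>M)"
      by (rule nn_integral_cmult[symmetric]) measurable
    finally show ?thesis by (simp add: mult_ac)
  qed

  \<comment> \<open>Read from right to left, the constant \<open>g n\<close> may be traded for the
    random coefficient against any \<open>F n\<close>-measurable weight, in particular the squared
    residual.\<close>
  have cond3: "(\<integral>\<^sup>+\<omega>. h \<omega> * ennreal (\<mu> n \<omega> * (1 - \<mu> n \<omega>)) \<partial>M) = (\<integral>\<^sup>+\<omega>. h \<omega> * ennreal (g n) \<partial>M)"
    if h: "h \<in> borel_measurable (F n)" for n h
  proof -
    have [measurable]: "h \<in> borel_measurable M" using h sub measurable_from_subalg by blast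
    have "(\<integral>\<^sup>+\<omega>. ennreal (\<mu> n \<omega> * (1 - \<mu> n \<omega>)) * (h \<omega> * 1) \<partial>M) = ennreal (g n) * (\<integral>\<^sup>+\<omega>. h \<omega> * 1 \<partial>M)"
      unfolding g by (rule indep[OF h, of "\<lambda>m. ennreal (m * (1 - m))"]) measurable
    then show ?thesis
      by (simp add: nn_integral_multc mult_ac)
  qed

  have indic: "(indicator B :: 'a \<Rightarrow> ennreal) \<in> borel_measurable (F n)" if "B \<in> sets (F n)" for B n
    using that by (rule borel_measurable_indicator)

  \<comment> \<open>Pathwise summability of the errors\<close>
  have fin1: "AE \<omega> in M. (\<Sum>n. ennreal (a n * sqrt (C n \<omega>))) < \<infinity>"
    using assms(11) by (simp add: a_def C_def F_def)
  have fin2: "AE \<omega> in M. (\<Sum>n. ennreal (\<theta> n) * (b n * ennreal (C n \<omega>))) < \<infinity>"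
    using assms(12) by (simp add: b_def C_def F_def \<theta>_def mult.assoc)

  have sum1: "AE \<omega> in M. (\<Sum>n. ennreal (\<mu> n \<omega> * norm (e n \<omega>))) < \<infinity>"
  \<comment> \<open>With \<open>V\<close> zero, localization says that summable conditional bounds
    force pathwise summability.\<close>
  proof (rule AE_suminf_finite_of_cond_bound[where V = "\<lambda>_ _. 0", OF sub F_mono _ _ _ _ _ fin1])
    fix n B assume "B \<in> sets (F n)"
    from cond1[OF indic[OF this]]
    show "(\<integral>\<^sup>+\<omega>. indicator B \<omega> * (0 + ennreal (\<mu> n \<omega> * norm (e n \<omega>))) \<partial>M)
      \<le> (\<integral>\<^sup>+\<omega>. indicator B \<omega> * (0 + ennreal (a n * sqrt (C n \<omega>))) \<partial>M)"
      by simp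
  qed auto

  have sum2: "AE \<omega> in M. (\<Sum>n. ennreal (\<theta> n) * (ennreal (\<mu> n \<omega> / (1 - \<mu> n \<omega>)) * ennreal ((norm (e n \<omega>))\<^sup>2))) < \<infinity>"
  proof (rule AE_suminf_finite_of_cond_bound[where V = "\<lambda>_ _. 0", OF sub F_mono _ _ _ _ _ fin2])
    fix n B assume "B \<in> sets (F n)"
    \<comment> \<open>The deterministic weight \<open>\<theta> n\<close> is moved into the test
      function, so that \<open>cond2\<close> applies.\<close>
    from indic[OF this] have h: "(\<lambda>\<omega>. indicator B \<omega> * ennreal (\<theta> n)) \<in> borel_measurable (F n)" by simp
    show "(\<integral>\<^sup>+\<omega>. indicator B \<omega> * (0 + ennreal (\<theta> n) * (ennreal (\<mu> n \<omega> / (1 - \<mu> n \<omega>)) * ennreal ((norm (e n \<omega>))\<^sup>2))) \<partial>M)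
      \<le> (\<integral>\<^sup>+\<omega>. indicator B \<omega> * (0 + ennreal (\<theta> n) * (b n * ennreal (C n \<omega>))) \<partial>M)"
      using cond2[OF h] by (simp add: mult.assoc)
  qed auto

  \<comment> \<open>Boundedness of the paths and summability of the weighted squared
    residuals\<close>
  have rec': "AE \<omega> in M. \<forall>n. x (Suc n) \<omega> = x n \<omega> + \<mu> n \<omega> *\<^sub>R (T (x n \<omega>) + e n \<omega> - x n \<omega>)
      \<and> 0 < \<mu> n \<omega> \<and> \<mu> n \<omega> < 1"
    using rec \<mu> by (simp add: AE_all_countable AE_conj_iff)

  \<comment> \<open>The bound may depend on the path. It controls the factor
    \<open>norm (x n \<omega> - z)\<close> in the conditional error \<open>t\<close> below.\<close>
  have bounded: "AE \<omega> in M. \<exists>R. \<forall>n. norm (x n \<omega> - z) \<le> R"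
    using sum1 rec'
  proof eventually_elim
    case (elim \<omega>)
    have nonneg: "0 \<le> \<mu> n \<omega> * norm (e n \<omega>)" for n
      using elim(2) by (simp add: less_imp_le)
    have "(\<Sum>n. ennreal (\<mu> n \<omega> * norm (e n \<omega>))) \<noteq> top"
      using elim(1) by simp
    then have "summable (\<lambda>n. \<mu> n \<omega> * norm (e n \<omega>))"
      by (rule summable_suminf_not_top[OF nonneg])
    then have "convergent (\<lambda>n. norm (x n \<omega> - z))"
    proof (rule quasi_decreasing_convergent[rotated 2])
      show "norm (x (Suc n) \<omega> - z) \<le> norm (x n \<omega> - z) + \<mu> n \<omega> * norm (e n \<omega>)" for n
        using elim(2) by (intro relaxed_step_dist[OF lip _ _ _ z]) auto
    qed (simp_all add: nonneg)
    then have "Bseq (\<lambda>n. norm (x n \<omega> - z))"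
      by (rule convergent_imp_Bseq)
    then show ?case by (auto simp: Bseq_def)
  qed

  \<comment> \<open>The first summand bounds the cross term of the squared distance estimate, the
    second the quadratic term after \<open>\<mu>\<^sup>2\<close> has been enlarged to
    \<open>\<mu> / (1 - \<mu>)\<close>.\<close>
  define t where "t = (\<lambda>n \<omega>. ennreal (2 * norm (x n \<omega> - z)) * ennreal (a n * sqrt (C n \<omega>)) + b n * ennreal (C n \<omega>))"

  have fin3: "AE \<omega> in M. (\<Sum>n. t n \<omega>) < \<infinity>"
    using fin1 fin2 bounded
  proof eventually_elim
    case (elim \<omega>)
    then obtain R where R: "\<And>n. norm (x n \<omega> - z) \<le> R" by blast
    have "t n \<omega> \<le> ennreal (2 * R) * ennreal (a n * sqrt (C n \<omega>))
        + ennreal (1 / g 0) * (ennreal (\<theta> n) * (b n * ennreal (C n \<omega>)))" for n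
      unfolding t_def
    proof (rule add_mono)
      show "ennreal (2 * norm (x n \<omega> - z)) * ennreal (a n * sqrt (C n \<omega>)) \<le> ennreal (2 * R) * ennreal (a n * sqrt (C n \<omega>))"
        using R[of n] by (intro mult_right_mono ennreal_leI) auto
      \<comment> \<open>The factor \<open>1 / g 0\<close> pays for inserting the weight
        \<open>\<theta> n\<close>, after which \<open>fin2\<close> applies.\<close>
      have "1 \<le> 1 / g 0 * \<theta> n" using \<theta>_ge[of n] g0 by (simp add: field_simps)
      then have "ennreal 1 \<le> ennreal (1 / g 0) * ennreal (\<theta> n)"
        using g0 \<theta>_nonneg by (subst ennreal_mult'[symmetric]) (auto intro: ennreal_leI)
      then have "1 * (b n * ennreal (C n \<omega>)) \<le> (ennreal (1 / g 0) * ennreal (\<theta> n)) * (b n * ennreal (C n \<omega>))"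
        by (intro mult_right_mono) auto
      then show "b n * ennreal (C n \<omega>) \<le> ennreal (1 / g 0) * (ennreal (\<theta> n) * (b n * ennreal (C n \<omega>)))"
        by (simp add: mult.assoc)
    qed
    then have "(\<Sum>n. t n \<omega>) \<le> (\<Sum>n. ennreal (2 * R) * ennreal (a n * sqrt (C n \<omega>))
        + ennreal (1 / g 0) * (ennreal (\<theta> n) * (b n * ennreal (C n \<omega>))))"
      by (intro suminf_le) auto
    also have "\<dots> = ennreal (2 * R) * (\<Sum>n. ennreal (a n * sqrt (C n \<omega>)))
        + ennreal (1 / g 0) * (\<Sum>n. ennreal (\<theta> n) * (b n * ennreal (C n \<omega>)))"
      by (subst suminf_add[symmetric]) auto
    also have "\<dots> < \<infinity>"
      using elim(1,2) by (simp add: ennreal_mult_less_top)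
    finally show ?case .
  qed

  have sum3: "AE \<omega> in M. (\<Sum>n. ennreal (g n) * ennreal ((norm (T (x n \<omega>) - x n \<omega>))\<^sup>2)) < \<infinity>"
  proof (rule AE_suminf_finite_of_cond_bound[where V = "\<lambda>n \<omega>. ennreal ((norm (x n \<omega> - z))\<^sup>2)", OF sub F_mono _ _ _ _ _ fin3])
    show "t n \<in> borel_measurable (F n)" for n
      unfolding t_def by measurable
    have x0: "integrable M (\<lambda>\<omega>. (norm (x 0 \<omega>))\<^sup>2)"
      using assms(5) by (simp add: L2_rv_def)
    have "integrable M (\<lambda>\<omega>. (norm (x 0 \<omega> - z))\<^sup>2)"
    proof (rule Bochner_Integration.integrable_bound)
      show "integrable M (\<lambda>\<omega>. 2 * (norm (x 0 \<omega>))\<^sup>2 + 2 * (norm z)\<^sup>2)"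
        using x0 by simp
      have "(norm (x 0 \<omega> - z))\<^sup>2 \<le> 2 * (norm (x 0 \<omega>))\<^sup>2 + 2 * (norm z)\<^sup>2" for \<omega>
      proof -
        have "(norm (x 0 \<omega> - z))\<^sup>2 \<le> (norm (x 0 \<omega>) + norm z)\<^sup>2"
          by (intro power_mono norm_triangle_ineq4) simp
        also have "\<dots> \<le> 2 * (norm (x 0 \<omega>))\<^sup>2 + 2 * (norm z)\<^sup>2"
          using sum_squares_bound[of "norm (x 0 \<omega>)" "norm z"] by (simp add: power2_sum)
        finally show ?thesis .
      qed
      then show "AE \<omega> in M. norm ((norm (x 0 \<omega> - z))\<^sup>2) \<le> norm (2 * (norm (x 0 \<omega>))\<^sup>2 + 2 * (norm z)\<^sup>2)"
        by (intro AE_I2) simp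
    qed measurable
    then show "(\<integral>\<^sup>+\<omega>. ennreal ((norm (x 0 \<omega> - z))\<^sup>2) \<partial>M) < \<infinity>"
      by (simp add: nn_integral_eq_integral)
    fix n B assume B: "B \<in> sets (F n)"
    have [measurable]: "B \<in> sets M" using B sub by (auto simp: subalgebra_def)
    note [measurable] = indic[OF B]
    let ?V = "\<lambda>n \<omega>. ennreal ((norm (x n \<omega> - z))\<^sup>2)"
    let ?r = "\<lambda>\<omega>. ennreal ((norm (T (x n \<omega>) - x n \<omega>))\<^sup>2)"
    let ?m = "\<lambda>\<omega>. ennreal (\<mu> n \<omega> * (1 - \<mu> n \<omega>))"
    let ?d = "\<lambda>\<omega>. ennreal (2 * norm (x n \<omega> - z))"
    let ?p = "\<lambda>\<omega>. ennreal (\<mu> n \<omega> * norm (e n \<omega>))"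
    let ?q = "\<lambda>\<omega>. ennreal (\<mu> n \<omega> / (1 - \<mu> n \<omega>)) * ennreal ((norm (e n \<omega>))\<^sup>2)"
    let ?I = "indicator B :: 'a \<Rightarrow> ennreal"
    have "(\<integral>\<^sup>+\<omega>. ?I \<omega> * (?V (Suc n) \<omega> + ennreal (g n) * ?r \<omega>) \<partial>M)
        = (\<integral>\<^sup>+\<omega>. ?I \<omega> * ?V (Suc n) \<omega> \<partial>M) + (\<integral>\<^sup>+\<omega>. (?I \<omega> * ?r \<omega>) * ennreal (g n) \<partial>M)"
      by (subst nn_integral_add[symmetric]) (simp_all add: distrib_left mult_ac)
    \<comment> \<open>Indicator and residual are \<open>F n\<close>-measurable, so
      \<open>g n\<close> can be exchanged for \<open>\<mu> n * (1 - \<mu> n)\<close>, the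
      coefficient in the pathwise inequality.\<close>
    also have "\<dots> = (\<integral>\<^sup>+\<omega>. ?I \<omega> * ?V (Suc n) \<omega> \<partial>M) + (\<integral>\<^sup>+\<omega>. (?I \<omega> * ?r \<omega>) * ?m \<omega> \<partial>M)"
      by (subst cond3) simp_all
    also have "\<dots> = (\<integral>\<^sup>+\<omega>. ?I \<omega> * (?V (Suc n) \<omega> + ?m \<omega> * ?r \<omega>) \<partial>M)"
      by (subst nn_integral_add[symmetric]) (simp_all add: distrib_left mult_ac)
    also have "\<dots> \<le> (\<integral>\<^sup>+\<omega>. ?I \<omega> * (?V n \<omega> + (?d \<omega> * ?p \<omega> + ?q \<omega>)) \<partial>M)"
    proof (rule nn_integral_mono_AE)
      show "AE \<omega> in M. ?I \<omega> * (?V (Suc n) \<omega> + ?m \<omega> * ?r \<omega>) \<le> ?I \<omega> * (?V n \<omega> + (?d \<omega> * ?p \<omega> + ?q \<omega>))"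
        using rec'
      proof eventually_elim
        case (elim \<omega>)
        then have m: "0 < \<mu> n \<omega>" "\<mu> n \<omega> < 1" by auto
        have "(\<mu> n \<omega>)\<^sup>2 \<le> \<mu> n \<omega>"
          using m by (simp add: power2_eq_square mult_left_le)
        also have "\<dots> \<le> \<mu> n \<omega> / (1 - \<mu> n \<omega>)"
          using m by (simp add: pos_le_divide_eq mult_left_le)
        finally have "(\<mu> n \<omega>)\<^sup>2 \<le> \<mu> n \<omega> / (1 - \<mu> n \<omega>)" .
        then have "(\<mu> n \<omega>)\<^sup>2 * (norm (e n \<omega>))\<^sup>2 \<le> \<mu> n \<omega> / (1 - \<mu> n \<omega>) * (norm (e n \<omega>))\<^sup>2"
          by (intro mult_right_mono) auto
        moreover have "(norm (x (Suc n) \<omega> - z))\<^sup>2 + \<mu> n \<omega> * (1 - \<mu> n \<omega>) * (norm (T (x n \<omega>) - x n \<omega>))\<^sup>2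
          \<le> (norm (x n \<omega> - z))\<^sup>2 + (2 * \<mu> n \<omega> * norm (e n \<omega>) * norm (x n \<omega> - z) + (\<mu> n \<omega>)\<^sup>2 * (norm (e n \<omega>))\<^sup>2)"
          using elim m by (intro relaxed_step_dist_sq[OF lip _ _ _ z]) auto
        ultimately have "(norm (x (Suc n) \<omega> - z))\<^sup>2 + \<mu> n \<omega> * (1 - \<mu> n \<omega>) * (norm (T (x n \<omega>) - x n \<omega>))\<^sup>2
          \<le> (norm (x n \<omega> - z))\<^sup>2 + (2 * norm (x n \<omega> - z) * (\<mu> n \<omega> * norm (e n \<omega>))
            + \<mu> n \<omega> / (1 - \<mu> n \<omega>) * (norm (e n \<omega>))\<^sup>2)"
          by (simp add: mult_ac)
        from ennreal_leI[OF this] show ?case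
          using m by (intro mult_left_mono) (simp_all add: ennreal_mult'' del: times_divide_eq_left)
      qed
    qed
    also have "\<dots> = (\<integral>\<^sup>+\<omega>. ?I \<omega> * ?V n \<omega> \<partial>M) + ((\<integral>\<^sup>+\<omega>. (?I \<omega> * ?d \<omega>) * ?p \<omega> \<partial>M) + (\<integral>\<^sup>+\<omega>. ?I \<omega> * ?q \<omega> \<partial>M))"
      by (subst nn_integral_add[symmetric], measurable)+ (simp add: distrib_left mult_ac)
    \<comment> \<open>The distance \<open>?d\<close> is absorbed into the test function of
      \<open>cond1\<close>; both error terms thereby become the \<open>F n\<close>-measurable
      summands of \<open>t n\<close>.\<close>
    also have "\<dots> \<le> (\<integral>\<^sup>+\<omega>. ?I \<omega> * ?V n \<omega> \<partial>M) + ((\<integral>\<^sup>+\<omega>. (?I \<omega> * ?d \<omega>) * ennreal (a n * sqrt (C n \<omega>)) \<partial>M)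
        + (\<integral>\<^sup>+\<omega>. ?I \<omega> * (b n * ennreal (C n \<omega>)) \<partial>M))"
      by (intro add_left_mono add_mono cond1 eq_refl[OF cond2]) measurable
    also have "\<dots> = (\<integral>\<^sup>+\<omega>. ?I \<omega> * (?V n \<omega> + t n \<omega>) \<partial>M)"
      unfolding t_def
      by (subst nn_integral_add[symmetric], measurable)+ (simp add: distrib_left mult_ac)
    finally show "(\<integral>\<^sup>+\<omega>. ?I \<omega> * (?V (Suc n) \<omega> + ennreal (g n) * ?r \<omega>) \<partial>M)
      \<le> (\<integral>\<^sup>+\<omega>. ?I \<omega> * (?V n \<omega> + t n \<omega>) \<partial>M)" .
  qed measurable

  \<comment> \<open>Conclusion along a fixed path\<close>
  show ?thesis
    using sum2 sum3 rec'
  proof eventually_elim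
    case (elim \<omega>)
    define c where "c = (\<lambda>n. \<mu> n \<omega> / (1 - \<mu> n \<omega>) * (norm (e n \<omega>))\<^sup>2)"
    have c: "0 \<le> c n" for n
      using elim(3) by (simp add: c_def less_imp_le)
    have "(\<Sum>n. ennreal (\<theta> n * c n)) = (\<Sum>n. ennreal (\<theta> n) * (ennreal (\<mu> n \<omega> / (1 - \<mu> n \<omega>)) * ennreal ((norm (e n \<omega>))\<^sup>2)))"
      using \<theta>_nonneg by (simp add: ennreal_mult' c_def ennreal_mult'' del: times_divide_eq_left)
    then have "(\<Sum>n. ennreal (\<theta> n * c n)) \<noteq> top" using elim(1) by simp
    then have sum_c: "summable (\<lambda>n. \<theta> n * c n)"
      using c \<theta>_nonneg by (intro summable_suminf_not_top) auto
    have "(\<Sum>n. ennreal (g n * (norm (T (x n \<omega>) - x n \<omega>))\<^sup>2)) \<noteq> top"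
      using elim(2) by (simp add: ennreal_mult'')
    then have sum_r: "summable (\<lambda>n. g n * (norm (T (x n \<omega>) - x n \<omega>))\<^sup>2)"
      using g_nonneg by (intro summable_suminf_not_top) auto
    have "(\<lambda>n. norm (T (x (Suc n) \<omega>) - x (Suc n) \<omega>) * sqrt (\<Sum>k\<le>n. g k)) \<longlonglongrightarrow> 0"
    proof (rule little_o_inverse_sqrt_partial_sums[where c = c and r = "\<lambda>n. norm (T (x n \<omega>) - x n \<omega>)"])
      show "(norm (T (x (Suc n) \<omega>) - x (Suc n) \<omega>))\<^sup>2 \<le> (norm (T (x n \<omega>) - x n \<omega>))\<^sup>2 + c n" for n
        unfolding c_def using elim(3) by (intro relaxed_step_residual[OF lip]) auto
    qed (use g_nonneg g_div c sum_c sum_r in \<open>simp_all flip: \<theta>_sum\<close>)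
    then show ?case by (simp add: \<theta>_sum flip: \<theta>_def)
  qed
qed

end
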